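(* The kernel for the periodic logarithmic energy is given by $$K_{\log}^{\mathrm p}(x,y)=\lim_{s\to0^+}K_{\text{log-Riesz},s}^{\mathrm p}(x,y),\qquad x,y\in\mathbb R^d.$$
   Context: Let $V$ be a real $d\times d$ matrix with linearly independent columns $v_1,\dots,v_d$ and $\det V=1$; $\mathcal V=\{Vk:k\in\mathbb Z^d\}$; $\mathcal V^*=\{w\in\mathbb R^d: w\cdot v\in\mathbb Z\ \forall v\in\mathcal V\}$. For a signed measure $\mu$ on $(0,\infty)$ define the kernel (with values in $\mathbb R\cup\{\infty\}$) $$K[\mu](x,y)=\sum_{v\in\mathcal V}\int_1^\infty e^{-|x-y+v|^2t}\,d\mu(t)+\sum_{w\in\mathcal V^*\setminus\{0\}}e^{2\pi i w\cdot(x-y)}\int_0^1\frac{\pi^{d/2}}{t^{d/2}}e^{-\pi^2|w|^2/t}\,d\mu(t).$$ The periodic logarithmic kernel is $K_{\log}^{\mathrm p}=K[\mu]$ with $d\mu(t)=t^{-1}\,dt$, the measure associated with the logarithmic potential via $-\log(|q|^2)=\lim_{\alpha\to0^+}\big(\int_\alpha^\infty e^{-|q|^2t}t^{-1}\,dt+\gamma+\log\alpha\big)$ ($\gamma$ the Euler–Mascheroni constant). For $s>0$, the periodic log-Riesz kernel is $K_{\text{log-Riesz},s}^{\mathrm p}=K[\tilde\mu_s]$ with $d\tilde\mu_s(t)=\Gamma(s/2)^{-1}t^{s/2-1}(\log t-\psi(s/2))\,dt$, $\psi=\Gamma'/\Gamma$, the measure representing the log-Riesz potential $|q|^{-s}\log(|q|^{-2})=\int_0^\infty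 e^{-|q|^2t}\,d\tilde\mu_s(t)$, $q\neq0$. *)

theory Defs
  imports "HOL-Analysis.Analysis"
begin

definition lattice :: "real^'n^'n \<Rightarrow> (real^'n) set" where
  "lattice V = range (\<lambda>k::int^'n. V *v (\<chi> i. of_int (k $ i)))"

definition dual_lattice :: "real^'n^'n \<Rightarrow> (real^'n) set" where
  "dual_lattice V = {w. \<forall>v\<in>lattice V. w \<bullet> v \<in> \<int>}"

text \<open>
  A signed measure is represented by its Jordan decomposition, a pair consisting of its positive
  and its negative part. At most one of the two is meant to be infinite.
\<close>

type_synonym signed_measure = "real measure \<times> real measure"

text \<open>
  The signed measure \<open>g(t) dt\<close> on \<open>(0,\<infinity>)\<close>. Since \<^const>\<open>ennreal\<close> sends negative numbers to \<open>0\<close>,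
  the two components have the positive and the negative part of \<open>g\<close> as their densities.
\<close>

definition signed_density :: "(real \<Rightarrow> real) \<Rightarrow> signed_measure" where
  "signed_density g =
     (density (restrict_space lborel {0<..}) (\<lambda>t. ennreal (g t)),
      density (restrict_space lborel {0<..}) (\<lambda>t. ennreal (- g t)))"

text \<open>The integral over \<open>[1,\<infinity>)\<close> may be infinite: it is \<open>\<infinity>\<close> in the cases of interest when \<open>q = 0\<close>.\<close>

definition direct_integral :: "signed_measure \<Rightarrow> real^'n \<Rightarrow> ereal" where
  "direct_integral \<mu> q =
     enn2ereal (\<integral>\<^sup>+t\<in>{1..}. ennreal (exp (- (norm q)\<^sup>2 * t)) \<partial>fst \<mu>) -
     enn2ereal (\<integral>\<^sup>+t\<in>{1..}. ennreal (exp (- (norm q)\<^sup>2 * t)) \<partial>snd \<mu>)"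

text \<open>
  The point \<open>1\<close> is assigned to the first integral only, so that an atom there is not counted twice.
\<close>

definition dual_integral :: "signed_measure \<Rightarrow> real^'n \<Rightarrow> real" where
  "dual_integral \<mu> w =
     (let d = real CARD('n);
          f = (\<lambda>t. pi powr (d / 2) / t powr (d / 2) * exp (- pi\<^sup>2 * (norm w)\<^sup>2 / t))
      in (LINT t:{0<..<1}|fst \<mu>. f t) - (LINT t:{0<..<1}|snd \<mu>. f t))"

definition dual_sum :: "real^'n^'n \<Rightarrow> signed_measure \<Rightarrow> real^'n \<Rightarrow> complex" where
  "dual_sum V \<mu> q =
     (\<Sum>\<^sub>\<infinity>w\<in>dual_lattice V - {0}.
        exp (2 * of_real pi * \<i> * of_real (w \<bullet> q)) * of_real (dual_integral \<mu> w))"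

lemma dual_sum_real: "dual_sum V \<mu> q \<in> \<real>"
proof -
  let ?A = "dual_lattice V - {0}"
  let ?f = "\<lambda>w. exp (2 * of_real pi * \<i> * of_real (w \<bullet> q)) * complex_of_real (dual_integral \<mu> w)"
  have bij: "bij_betw uminus ?A ?A"
    by (rule bij_betw_byWitness[where f' = uminus]) (auto simp: dual_lattice_def)
  have "cnj (dual_sum V \<mu> q) = (\<Sum>\<^sub>\<infinity>w\<in>?A. cnj (?f w))"
    unfolding dual_sum_def by (rule infsum_cnj[symmetric])
  also have "\<dots> = (\<Sum>\<^sub>\<infinity>w\<in>?A. ?f (- w))"
    by (simp add: exp_cnj dual_integral_def)
  also have "\<dots> = dual_sum V \<mu> q"
    unfolding dual_sum_def by (rule infsum_reindex_bij_betw[OF bij])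
  finally show ?thesis
    by (simp add: Reals_cnj_iff)
qed

text \<open>
  The first sum is taken in the extended reals, so it is \<open>\<infinity>\<close> if one summand is. In the second sum,
  \<^const>\<open>Re\<close> is only a change of type, by \<open>dual_sum_real\<close>.
\<close>

definition periodic_kernel ::
    "real^'n^'n \<Rightarrow> signed_measure \<Rightarrow> real^'n \<Rightarrow> real^'n \<Rightarrow> ereal" where
  "periodic_kernel V \<mu> x y =
     (\<Sum>\<^sub>\<infinity>v\<in>lattice V. direct_integral \<mu> (x - y + v)) + ereal (Re (dual_sum V \<mu> (x - y)))"

definition log_measure :: signed_measure where
  "log_measure = signed_density (\<lambda>t. 1 / t)"

definition log_Riesz_measure :: "real \<Rightarrow> signed_measure" where
  "log_Riesz_measure s =
     signed_density (\<lambda>t. 1 / Gamma (s / 2) * t powr (s / 2 - 1) * (ln t - Digamma (s / 2)))"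

definition K_log :: "real^'n^'n \<Rightarrow> real^'n \<Rightarrow> real^'n \<Rightarrow> ereal" where
  "K_log V = periodic_kernel V log_measure"

definition K_log_Riesz :: "real^'n^'n \<Rightarrow> real \<Rightarrow> real^'n \<Rightarrow> real^'n \<Rightarrow> ereal" where
  "K_log_Riesz V s = periodic_kernel V (log_Riesz_measure s)"

end

(*
  With a = 1 / Gamma(s/2) and b = - psi(s/2) / Gamma(s/2), the log-Riesz measure has the density
  t^(s/2-1) (a log t + b). As s -> 0+, the recurrences of Gamma and psi give a -> 0 and b -> 1, so the
  densities converge to 1/t. They do so under bounds that are uniform in small s, and dominated
  convergence applies to each integral. The dominating terms decay like Gaussians in the lattice
  vectors, so they are summable, and dominated convergence applies to the two lattice sums as well.
  If x - y is a lattice vector, both sides are infinite because 1/t is not integrable on [1, infinity).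
*)
theory Submission
  imports Defs
begin

section \<open>Dominated convergence for unordered sums\<close>

lemma summable_on_real_iff_integrable:
  fixes f :: "'a \<Rightarrow> real"
  shows "f summable_on A \<longleftrightarrow> Infinite_Set_Sum.abs_summable_on f A"
  using summable_on_iff_abs_summable_on_real abs_summable_equivalent by blast

text \<open>An absolutely convergent unordered sum is an integral against the counting measure, so
  Lebesgue's theorem applies. The limit \<open>g\<close> inherits the bound \<open>h\<close>, which
  makes its sum absolutely convergent as well.\<close>

lemma tendsto_infsum_dominated:
  fixes f :: "nat \<Rightarrow> 'a \<Rightarrow> 'b::{banach, second_countable_topology}"
  assumes h: "h summable_on A"
    and le: "\<And>n x. x \<in> A \<Longrightarrow> norm (f n x) \<le> h x"
    and lim: "\<And>x. x \<in> A \<Longrightarrow> (\<lambda>n. f n x) \<longlonglongrightarrow> g x"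
  shows "(\<lambda>n. infsum (f n) A) \<longlonglongrightarrow> infsum g A"
proof -
  have h': "Infinite_Set_Sum.abs_summable_on h A"
    using h by (simp only: summable_on_real_iff_integrable)
  have f: "Infinite_Set_Sum.abs_summable_on (f n) A" for n
    using h' le by (rule Infinite_Set_Sum.abs_summable_on_comparison_test')
  have g: "Infinite_Set_Sum.abs_summable_on g A"
    using h'
  proof (rule Infinite_Set_Sum.abs_summable_on_comparison_test')
    show "norm (g x) \<le> h x" if "x \<in> A" for x
      using tendsto_norm[OF lim[OF that]] le[OF that] by (intro tendsto_upperbound) auto
  qed
  have "(\<lambda>n. infsetsum (f n) A) \<longlonglongrightarrow> infsetsum g A"
    unfolding infsetsum_def
  proof (rule integral_dominated_convergence[where w = h])
    show "integrable (count_space A) h"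
      using h' by (simp add: Infinite_Set_Sum.abs_summable_on_def)
  qed (auto simp: AE_count_space le lim)
  then show ?thesis
    by (simp add: infsetsum_infsum f g)
qed

section \<open>Gaussian sums over lattices and their consequences for discreteness\<close>

lemma summable_on_exp_square_int:
  assumes "c > 0"
  shows "(\<lambda>k::int. exp (- c * (of_int k)\<^sup>2) :: real) summable_on UNIV"
proof -
  \<comment> \<open>Since k <= k^2 for natural k, a geometric series dominates.\<close>
  have sq: "exp (- c * (real k)\<^sup>2) \<le> exp (- c) ^ k" for k
  proof -
    have "real k \<le> (real k)\<^sup>2"
      by (cases k) (auto simp: power2_eq_square)
    then have "c * real k \<le> c * (real k)\<^sup>2"
      using assms by (intro mult_left_mono) auto
    then show ?thesis
      by (simp add: exp_of_nat_mult[symmetric] mult.commute)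
  qed
  have geo: "(\<lambda>k. exp (- c) ^ k :: real) summable_on UNIV"
    using assms by (subst summable_on_UNIV_nonneg_real_iff) (auto intro!: summable_geometric)
  have nat: "(\<lambda>k::nat. exp (- c * (of_nat k)\<^sup>2) :: real) summable_on UNIV"
    using geo by (rule summable_on_comparison_test) (use sq in auto)
  \<comment> \<open>The two halves overlap at 0, which is harmless for summability over a
    union.\<close>
  have "UNIV = range int \<union> range (\<lambda>k. - int k)"
    by (auto simp: image_iff) (metis int_cases2)
  moreover have "(\<lambda>k::int. exp (- c * (of_int k)\<^sup>2) :: real) summable_on range int"
    using nat by (subst summable_on_reindex) (auto simp: o_def)
  moreover have "(\<lambda>k::int. exp (- c * (of_int k)\<^sup>2) :: real) summable_on range (\<lambda>k. - int k)"
    using nat by (subst summable_on_reindex) (auto simp: o_def inj_on_def)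
  ultimately show ?thesis
    by (metis summable_on_union)
qed

text \<open>The Gaussian factors over the coordinates, so the sum over integer vectors reduces to a
  product of one-dimensional sums.\<close>

lemma summable_on_exp_norm_integer_vectors:
  assumes "c > 0"
  shows "(\<lambda>u::real^'n. exp (- c * (norm u)\<^sup>2)) summable_on {u. \<forall>i. u $ i \<in> \<int>}"
proof -
  let ?h = "\<lambda>k::'n \<Rightarrow> int. \<chi> i. real_of_int (k i)"
  have "Infinite_Set_Sum.abs_summable_on (\<lambda>k::int. exp (- c * (real_of_int k)\<^sup>2)) UNIV"
    using summable_on_exp_square_int[OF assms] by (simp only: summable_on_real_iff_integrable)
  then have "Infinite_Set_Sum.abs_summable_on
          (\<lambda>k. \<Prod>i\<in>(UNIV::'n set). exp (- c * (real_of_int (k i))\<^sup>2)) (Pi\<^sub>E UNIV (\<lambda>_. UNIV))"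
    by (intro Infinite_Set_Sum.abs_summable_on_prod_PiE) auto
  then have "(\<lambda>k::'n \<Rightarrow> int. \<Prod>i\<in>UNIV. exp (- c * (real_of_int (k i))\<^sup>2)) summable_on UNIV"
    by (simp only: summable_on_real_iff_integrable PiE_UNIV_domain Pi_UNIV)
  moreover have "(\<Prod>i\<in>UNIV. exp (- c * (real_of_int (k i))\<^sup>2)) = exp (- c * (norm (?h k))\<^sup>2)" for k
    by (simp add: exp_sum[symmetric] sum_negf sum_distrib_left norm_vec_def L2_set_def sum_nonneg)
  ultimately have "(\<lambda>k. exp (- c * (norm (?h k))\<^sup>2)) summable_on UNIV"
    by simp
  moreover have "inj ?h"
    by (auto simp: inj_on_def vec_eq_iff)
  moreover have "{u. \<forall>i. u $ i \<in> \<int>} = range ?h"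
  proof (intro equalityI subsetI)
    fix u :: "real^'n" assume "u \<in> {u. \<forall>i. u $ i \<in> \<int>}"
    then have "u = ?h (\<lambda>i. \<lfloor>u $ i\<rfloor>)"
      by (auto simp: vec_eq_iff)
    then show "u \<in> range ?h" by (rule range_eqI[where f = ?h])
  qed auto
  ultimately show ?thesis
    by (simp add: summable_on_reindex o_def)
qed

text \<open>The injective map \<open>M\<close> carries \<open>S\<close> into the integer vectors and
  enlarges norms by a bounded factor at most, while the shift by \<open>q\<close> costs only a
  constant factor. For the lattice of \<open>V\<close>, \<open>M\<close> will be the inverse of
  \<open>V\<close>; for the dual lattice, the transpose of \<open>V\<close>.\<close>

lemma summable_on_exp_norm_lattice:
  fixes M :: "real^'n^'n" and q :: "real^'n"
  assumes "invertible M" and int: "\<And>v i. v \<in> S \<Longrightarrow> (M *v v) $ i \<in> \<int>" and "a > 0"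
  shows "(\<lambda>v. exp (- a * (norm (q + v))\<^sup>2)) summable_on S"
proof -
  \<comment> \<open>Adding 1 to the operator norm makes \<open>K\<close> positive, so that
    \<open>c\<close> below can be formed by division.\<close>
  define K where "K = onorm ((*v) M) + 1"
  have bl: "bounded_linear ((*v) M)" by simp
  have K: "K > 0" "norm (M *v v) \<le> K * norm v" for v
    using onorm_pos_le[OF bl] onorm[OF bl, of v] by (auto simp: K_def algebra_simps add_increasing)
  \<comment> \<open>Chosen so that c |M v|^2 <= a |v|^2 / 2. The factor 1/2 is what removing the
    shift costs: |v|^2 / 2 <= |q + v|^2 + |q|^2.\<close>
  define c where "c = a / (2 * K\<^sup>2)"
  have c: "c > 0" using K assms by (simp add: c_def)
  have inj: "inj_on ((*v) M) S"
    using inj_matrix_vector_mult[OF assms(1)] by (rule inj_on_subset) simp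
  have "(\<lambda>u. exp (- c * (norm u)\<^sup>2)) summable_on ((*v) M ` S)"
    using summable_on_exp_norm_integer_vectors[OF c] by (rule summable_on_subset) (use int in auto)
  then have "(\<lambda>v. exp (- c * (norm (M *v v))\<^sup>2)) summable_on S"
    using inj by (simp add: summable_on_reindex o_def)
  then have "(\<lambda>v. exp (a * (norm q)\<^sup>2) * exp (- c * (norm (M *v v))\<^sup>2)) summable_on S"
    by (rule summable_on_cmult_right)
  then show ?thesis
  proof (rule summable_on_comparison_test)
    fix v
    have "(norm (M *v v))\<^sup>2 \<le> K\<^sup>2 * (norm v)\<^sup>2"
      using K power_mono[of "norm (M *v v)" "K * norm v" 2] by (simp add: power_mult_distrib)
    then have "c * (norm (M *v v))\<^sup>2 \<le> c * (K\<^sup>2 * (norm v)\<^sup>2)"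
      using c by (intro mult_left_mono) auto
    also have "\<dots> = a * ((norm v)\<^sup>2 / 2)"
      using K by (simp add: c_def)
    also have "(norm v)\<^sup>2 / 2 \<le> (norm (q + v))\<^sup>2 + (norm q)\<^sup>2"
    proof -
      have "norm v \<le> norm (q + v) + norm q"
        using norm_triangle_ineq4[of "q + v" q] by simp
      then have "(norm v)\<^sup>2 \<le> (norm (q + v) + norm q)\<^sup>2"
        by (intro power_mono) auto
      then show ?thesis
        using sum_squares_bound[of "norm (q + v)" "norm q"] by (simp add: power2_sum)
    qed
    finally have "c * (norm (M *v v))\<^sup>2 \<le> a * ((norm (q + v))\<^sup>2 + (norm q)\<^sup>2)"
      using assms by simp
    then show "exp (- a * (norm (q + v))\<^sup>2) \<le> exp (a * (norm q)\<^sup>2) * exp (- c * (norm (M *v v))\<^sup>2)"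
      by (simp add: exp_add[symmetric] algebra_simps)
  qed auto
qed

text \<open>Discreteness is read off from summability: each point with |q + v| < 1 contributes at
  least exp(-1) to a finite sum, so there are finitely many. The resulting gap \<open>m\<close>
  makes the later bounds on integrands uniform over the lattice.\<close>

lemma norm_bounded_below_if_summable:
  fixes q :: "'a::real_normed_vector"
  assumes "(\<lambda>v. exp (- (norm (q + v))\<^sup>2)) summable_on S"
  obtains m where "m > 0" "\<And>v. v \<in> S \<Longrightarrow> q + v \<noteq> 0 \<Longrightarrow> m \<le> (norm (q + v))\<^sup>2"
proof -
  let ?f = "\<lambda>v. exp (- (norm (q + v))\<^sup>2)"
  define T where "T = {v \<in> S. (norm (q + v))\<^sup>2 < 1}"
  have "card F \<le> nat \<lceil>exp 1 * infsum ?f S\<rceil>" if F: "F \<subseteq> T" "finite F" for F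
  proof -
    have "real (card F) * exp (- 1) = (\<Sum>v\<in>F. exp (- 1))" by simp
    also have "\<dots> \<le> sum ?f F" using F by (intro sum_mono) (auto simp: T_def)
    also have "\<dots> \<le> infsum ?f S"
      using assms F by (intro finite_sum_le_infsum) (auto simp: T_def)
    finally have "real (card F) \<le> exp 1 * infsum ?f S"
      by (simp add: exp_minus field_simps)
    then show ?thesis by linarith
  qed
  then have "finite T"
    using finite_if_finite_subsets_card_bdd by metis
  \<comment> \<open>The element 1 keeps the set nonempty and bounds the points outside
    \<open>T\<close>; removing \<open>- q\<close> leaves only positive values.\<close>
  then have fin: "finite (insert 1 ((\<lambda>v. (norm (q + v))\<^sup>2) ` (T - {- q})))" (is "finite ?R") by simp
  show thesis
  proof
    show "Min ?R > 0"
      using fin by (subst Min_gr_iff) (auto simp: add_eq_0_iff2)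
    show "Min ?R \<le> (norm (q + v))\<^sup>2" if "v \<in> S" "q + v \<noteq> 0" for v
    proof (cases "v \<in> T")
      case True
      then show ?thesis using fin that by (intro Min_le) (auto simp: add_eq_0_iff2)
    next
      case False
      have "Min ?R \<le> 1" using fin by (intro Min_le) auto
      with False that show ?thesis by (simp add: T_def)
    qed
  qed
qed

lemma integer_coordinates_lattice:
  fixes V W :: "real^'n^'n"
  assumes "W ** V = mat 1" "v \<in> lattice V"
  shows "(W *v v) $ i \<in> \<int>"
  using assms by (auto simp: lattice_def matrix_vector_mul_assoc)

text \<open>The coordinates of \<open>transpose V *v w\<close> are the inner products of
  \<open>w\<close> with the columns of \<open>V\<close>, and these columns are lattice
  vectors.\<close>

lemma integer_coordinates_dual_lattice:
  fixes V :: "real^'n^'n"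
  assumes "w \<in> dual_lattice V"
  shows "(transpose V *v w) $ i \<in> \<int>"
proof -
  have "(\<chi> j. of_int ((axis i 1 :: int^'n) $ j)) = (axis i 1 :: real^'n)"
    by (auto simp: vec_eq_iff axis_def)
  then have "column i V \<in> lattice V"
    unfolding lattice_def by (metis matrix_vector_mult_basis rangeI)
  then have "w \<bullet> column i V \<in> \<int>"
    using assms by (auto simp: dual_lattice_def)
  then show ?thesis
    by (simp add: matrix_vector_mult_def transpose_def column_def inner_vec_def mult.commute)
qed

section \<open>Integrals against densities on the positive reals\<close>

lemma nn_integral_density_positive_reals:
  fixes g :: "real \<Rightarrow> real"
  assumes [measurable]: "g \<in> borel_measurable borel" "F \<in> borel_measurable borel" "A \<in> sets borel"
    and "A \<subseteq> {0<..}"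
  shows "(\<integral>\<^sup>+t\<in>A. F t \<partial>density (restrict_space lborel {0<..}) (\<lambda>t. ennreal (g t)))
    = (\<integral>\<^sup>+t\<in>A. ennreal (g t) * F t \<partial>lborel)"
proof -
  have "(\<integral>\<^sup>+t\<in>A. F t \<partial>density (restrict_space lborel {0<..}) (\<lambda>t. ennreal (g t)))
    = (\<integral>\<^sup>+t. ennreal (g t) * (F t * indicator A t) \<partial>restrict_space lborel {0<..})"
    by (intro nn_integral_density measurable_restrict_space1) auto
  also have "\<dots> = (\<integral>\<^sup>+t. ennreal (g t) * (F t * indicator A t) * indicator {0<..} t \<partial>lborel)"
    by (intro nn_integral_restrict_space) auto
  also have "\<dots> = (\<integral>\<^sup>+t\<in>A. ennreal (g t) * F t \<partial>lborel)"
    using assms(4) by (intro nn_integral_cong) (auto split: split_indicator simp: mult_ac)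
  finally show ?thesis .
qed

lemma set_integral_density_positive_reals:
  fixes f g :: "real \<Rightarrow> real"
  assumes [measurable]: "g \<in> borel_measurable borel" "f \<in> borel_measurable borel" "A \<in> sets borel"
    and "A \<subseteq> {0<..}"
  shows "(LINT t:A|density (restrict_space lborel {0<..}) (\<lambda>t. ennreal (g t)). f t)
    = (LINT t:A|lborel. max 0 (g t) * f t)"
proof -
  \<comment> \<open>\<open>ennreal\<close> truncates negative values to 0. The explicit truncation
    gives the nonnegative density that \<open>integral_density\<close> requires.\<close>
  have "(\<lambda>t. ennreal (g t)) = (\<lambda>t. ennreal (max 0 (g t)))"
    by (auto simp: max_def ennreal_neg)
  then have "(LINT t:A|density (restrict_space lborel {0<..}) (\<lambda>t. ennreal (g t)). f t)
    = (LINT t|density (restrict_space lborel {0<..}) (\<lambda>t. ennreal (max 0 (g t))). indicator A t *\<^sub>R f t)"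
    by (simp add: set_lebesgue_integral_def)
  also have "\<dots> = (LINT t|restrict_space lborel {0<..}. max 0 (g t) *\<^sub>R (indicator A t *\<^sub>R f t))"
    by (intro integral_density measurable_restrict_space1) auto
  also have "\<dots> = (LINT t|lborel. indicator {0<..} t *\<^sub>R (max 0 (g t) *\<^sub>R (indicator A t *\<^sub>R f t)))"
    by (intro integral_restrict_space) auto
  also have "\<dots> = (LINT t:A|lborel. max 0 (g t) * f t)"
    using assms(4) unfolding set_lebesgue_integral_def
    by (intro Bochner_Integration.integral_cong) (auto split: split_indicator)
  finally show ?thesis .
qed

text \<open>
  The upper bounds are the ones needed for dominated convergence; the lower bound makes the direct
  integral at the origin infinite.
\<close>

definition moderate_density :: "(real \<Rightarrow> real) \<Rightarrow> bool" where
  "moderate_density g \<longleftrightarrow> g \<in> borel_measurable borel \<and>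
     (\<forall>t\<ge>1. 1 / (2 * t) \<le> g t \<and> g t \<le> 3 * t) \<and> (\<forall>t. 0 < t \<and> t < 1 \<longrightarrow> \<bar>g t\<bar> \<le> 3 / t\<^sup>2)"

lemma moderate_densityD:
  assumes "moderate_density g"
  shows "g \<in> borel_measurable borel" "1 \<le> t \<Longrightarrow> 1 / (2 * t) \<le> g t" "1 \<le> t \<Longrightarrow> g t \<le> 3 * t"
    "1 \<le> t \<Longrightarrow> 0 \<le> g t" "0 < t \<Longrightarrow> t < 1 \<Longrightarrow> \<bar>g t\<bar> \<le> 3 / t\<^sup>2"
proof -
  show "0 \<le> g t" if "1 \<le> t"
    using assms that by (auto simp: moderate_density_def intro: order_trans[of 0 "1 / (2 * t)"])
qed (use assms in \<open>auto simp: moderate_density_def\<close>)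

section \<open>The direct integrals and their lattice sum\<close>

lemma direct_integral_moderate:
  fixes q :: "real^'n"
  assumes "moderate_density g"
  shows "direct_integral (signed_density g) q
    = enn2ereal (\<integral>\<^sup>+t\<in>{1..}. ennreal (g t * exp (- (norm q)\<^sup>2 * t)) \<partial>lborel)"
proof -
  note [measurable] = moderate_densityD(1)[OF assms]
  note nonneg = moderate_densityD(4)[OF assms]
  have "(\<integral>\<^sup>+t\<in>{1..}. ennreal (exp (- (norm q)\<^sup>2 * t)) \<partial>fst (signed_density g))
      = (\<integral>\<^sup>+t\<in>{1..}. ennreal (g t * exp (- (norm q)\<^sup>2 * t)) \<partial>lborel)"
    unfolding signed_density_def fst_conv
    by (subst nn_integral_density_positive_reals)
       (auto intro!: nn_integral_cong simp: nonneg ennreal_mult split: split_indicator)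
  \<comment> \<open>As \<open>g\<close> is nonnegative on [1, infinity), the negative part has no
    mass there, and the difference defining \<open>direct_integral\<close> is never infinity minus
    infinity.\<close>
  moreover have "(\<integral>\<^sup>+t\<in>{1..}. ennreal (exp (- (norm q)\<^sup>2 * t)) \<partial>snd (signed_density g)) = 0"
  proof -
    have "(\<integral>\<^sup>+t\<in>{1..}. ennreal (exp (- (norm q)\<^sup>2 * t)) \<partial>snd (signed_density g))
        = (\<integral>\<^sup>+t\<in>{1..}. ennreal (- g t) * ennreal (exp (- (norm q)\<^sup>2 * t)) \<partial>lborel)"
      unfolding signed_density_def snd_conv by (rule nn_integral_density_positive_reals) auto
    also have "\<dots> = (\<integral>\<^sup>+t. 0 \<partial>(lborel :: real measure))"
      by (rule nn_integral_cong) (auto simp: nonneg ennreal_neg split: split_indicator)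
    finally show ?thesis by simp
  qed
  ultimately show ?thesis
    by (simp add: direct_integral_def zero_ennreal.rep_eq)
qed

lemma direct_integral_zero:
  assumes "moderate_density g"
  shows "direct_integral (signed_density g) (0 :: real^'n) = \<infinity>"
proof -
  note [measurable] = moderate_densityD(1)[OF assms]
  let ?I = "\<integral>\<^sup>+t\<in>{1..}. ennreal (g t) \<partial>lborel"
  have "ennreal (real n) \<le> ?I" for n :: nat
  proof -
    \<comment> \<open>The endpoint \<open>exp (2 * real n)\<close> is chosen so that the minorant
      1/(2t) has integral exactly n.\<close>
    have "ennreal (real n) = ennreal (ln (exp (2 * real n)) / 2 - ln 1 / 2)"
      by simp
    also have "\<dots> = (\<integral>\<^sup>+t. ennreal (1 / (2 * t)) * indicator {1..exp (2 * real n)} t \<partial>lborel)"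
      by (rule nn_integral_FTC_Icc[symmetric]) (auto intro!: derivative_eq_intros)
    also have "\<dots> \<le> ?I"
      by (intro nn_integral_mono)
         (auto split: split_indicator intro!: ennreal_leI moderate_densityD(2)[OF assms])
    finally show ?thesis .
  qed
  then have "?I = \<infinity>"
    by (metis ennreal_Ex_less_of_nat infinity_ennreal_def ennreal_of_nat_eq_real_of_nat
        linorder_not_less top.not_eq_extremum)
  then show ?thesis
    by (simp add: direct_integral_moderate[OF assms])
qed

text \<open>Half of the exponential decay absorbs the factor t, by x <= exp x at x = a t / 2; the
  other half is integrable by an explicit antiderivative.\<close>

lemma set_integrable_mult_exp_minus:
  fixes a :: real
  assumes "a > 0"
  shows "set_integrable lborel {1..} (\<lambda>t. t * exp (- a * t))"
proof -
  have F: "((\<lambda>t. - exp (- (a / 2) * t) / (a / 2)) \<longlongrightarrow> 0) at_top"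
  proof -
    have "filterlim (\<lambda>t. a / 2 * t) at_top at_top"
      using assms by (intro filterlim_tendsto_pos_mult_at_top[OF tendsto_const] filterlim_ident) auto
    then have "((\<lambda>t. exp (- (a / 2 * t))) \<longlongrightarrow> 0) at_top"
      by (intro filterlim_compose[OF exp_at_bot] filterlim_compose[OF filterlim_uminus_at_bot_at_top])
    then have "((\<lambda>t. - exp (- (a / 2 * t)) / (a / 2)) \<longlongrightarrow> - 0 / (a / 2)) at_top"
      using assms by (intro tendsto_intros) auto
    then show ?thesis by simp
  qed
  have "(\<integral>\<^sup>+t. ennreal (exp (- (a / 2) * t)) * indicator {1..} t \<partial>lborel)
      = ennreal (0 - (- exp (- (a / 2) * 1) / (a / 2)))"
    using assms by (intro nn_integral_FTC_atLeast[OF _ _ _ F]) (auto intro!: derivative_eq_intros)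
  then have "set_integrable lborel {1..} (\<lambda>t. exp (- (a / 2) * t))"
    unfolding set_integrable_def
    by (intro integrableI_nonneg) (auto simp: ennreal_mult mult.commute ennreal_indicator)
  then have "set_integrable lborel {1..} (\<lambda>t. 2 / a * exp (- (a / 2) * t))"
    by (rule set_integrable_mult_right)
  then show ?thesis
  proof (rule set_integrable_bound)
    show "AE t in lborel. t \<in> {1..} \<longrightarrow> norm (t * exp (- a * t)) \<le> norm (2 / a * exp (- (a / 2) * t))"
    proof (intro AE_I2 impI)
      fix t :: real assume "t \<in> {1..}"
      have "a / 2 * t \<le> exp (a / 2 * t)"
        using exp_ge_add_one_self[of "a / 2 * t"] by linarith
      then have "t \<le> 2 / a * exp (a / 2 * t)"
        using assms by (simp add: field_simps)
      then have "t * exp (- a * t) \<le> 2 / a * exp (a / 2 * t) * exp (- a * t)"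
        by (intro mult_right_mono) auto
      also have "\<dots> = 2 / a * exp (- (a / 2) * t)"
        by (simp add: exp_add[symmetric] mult.assoc)
      finally show "norm (t * exp (- a * t)) \<le> norm (2 / a * exp (- (a / 2) * t))"
        using assms \<open>t \<in> {1..}\<close> by simp
    qed
  qed (auto simp: set_borel_measurable_def)
qed

text \<open>For t >= 1 the exponent splits as r t >= r/2 + (m/2) t. With r = |q + v|^2, the first
  half is a Gaussian that can be summed over the lattice, and the second is integrable in t
  uniformly in the lattice vector.\<close>

lemma direct_integrand_bound:
  assumes g: "moderate_density g" and "t \<ge> 1" "m \<le> r" "0 \<le> r"
  shows "\<bar>g t * exp (- r * t)\<bar> \<le> exp (- r / 2) * (3 * (t * exp (- (m / 2) * t)))"
proof -
  have "m / 2 * t \<le> r / 2 * t" "r / 2 * 1 \<le> r / 2 * t"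
    using assms mult_left_mono[of 1 t "r / 2"] by (auto intro!: mult_right_mono)
  then have "exp (- r * t) \<le> exp (- r / 2) * exp (- (m / 2) * t)"
    by (simp add: exp_add[symmetric])
  then have "g t * exp (- r * t) \<le> (3 * t) * (exp (- r / 2) * exp (- (m / 2) * t))"
    using moderate_densityD(3,4)[OF g \<open>t \<ge> 1\<close>] by (intro mult_mono) auto
  then show ?thesis
    using moderate_densityD(4)[OF g \<open>t \<ge> 1\<close>] by (simp add: mult_ac)
qed

lemma set_integrable_direct_integrand:
  assumes "moderate_density g" "r > 0"
  shows "set_integrable lborel {1..} (\<lambda>t. g t * exp (- r * t))"
proof -
  note [measurable] = moderate_densityD(1)[OF assms(1)]
  have "set_integrable lborel {1..} (\<lambda>t. exp (- r / 2) * (3 * (t * exp (- (r / 2) * t))))"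
    using assms by (intro set_integrable_mult_right set_integrable_mult_exp_minus) auto
  then show ?thesis
  proof (rule set_integrable_bound)
    show "AE t in lborel. t \<in> {1..} \<longrightarrow> norm (g t * exp (- r * t))
        \<le> norm (exp (- r / 2) * (3 * (t * exp (- (r / 2) * t))))"
      using direct_integrand_bound[OF assms(1), of _ r r] assms(2) by (auto intro!: AE_I2)
  qed (auto simp: set_borel_measurable_def)
qed

lemma direct_integral_nonzero:
  fixes q :: "real^'n"
  assumes g: "moderate_density g" and "q \<noteq> 0"
  shows "direct_integral (signed_density g) q = ereal (LINT t:{1..}|lborel. g t * exp (- (norm q)\<^sup>2 * t))"
proof -
  have "(\<integral>\<^sup>+t\<in>{1..}. ennreal (g t * exp (- (norm q)\<^sup>2 * t)) \<partial>lborel)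
      = (\<integral>\<^sup>+t. ennreal (indicator {1..} t *\<^sub>R (g t * exp (- (norm q)\<^sup>2 * t))) \<partial>lborel)"
    by (intro nn_integral_cong) (auto split: split_indicator)
  also have "\<dots> = ennreal (LINT t:{1..}|lborel. g t * exp (- (norm q)\<^sup>2 * t))"
    unfolding set_lebesgue_integral_def
    using set_integrable_direct_integrand[OF g, of "(norm q)\<^sup>2"] assms moderate_densityD(4)[OF g]
    by (intro nn_integral_eq_integral) (auto simp: set_integrable_def split: split_indicator)
  moreover have "0 \<le> (LINT t:{1..}|lborel. g t * exp (- (norm q)\<^sup>2 * t))"
    unfolding set_lebesgue_integral_def
    using moderate_densityD(4)[OF g] by (intro Bochner_Integration.integral_nonneg) (auto split: split_indicator)
  ultimately show ?thesis
    by (simp add: direct_integral_moderate[OF g])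
qed

lemma infsum_ereal:
  assumes "f summable_on A"
  shows "(\<Sum>\<^sub>\<infinity>v\<in>A. ereal (f v)) = ereal (infsum f A)"
  using infsum_comm_additive_general[where f = ereal and g = f and S = A] assms by (simp add: o_def)

text \<open>Nonnegative extended sums always exist and dominate each of their terms.\<close>

lemma infsum_ereal_eq_infinity:
  fixes f :: "'a \<Rightarrow> ereal"
  assumes "\<And>x. x \<in> A \<Longrightarrow> 0 \<le> f x" "a \<in> A" "f a = \<infinity>"
  shows "infsum f A = \<infinity>"
proof -
  have "infsum f {a} \<le> infsum f A"
    using assms by (intro infsum_mono_neutral nonneg_summable_on_complete) auto
  then show ?thesis using assms by simp
qed

text \<open>Dominated convergence is used twice, in t for each fixed \<open>v\<close> and then over
  \<open>v\<close>. It needs real values, so the sums are exhibited as embedded reals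
  \<open>L\<close> and \<open>Ls\<close>.\<close>

lemma tendsto_direct_sum:
  fixes q :: "real^'n"
  assumes gn: "\<And>n. moderate_density (gs n)" and g: "moderate_density g"
    and lim: "\<And>t. t > 0 \<Longrightarrow> (\<lambda>n. gs n t) \<longlonglongrightarrow> g t"
    and summ: "\<And>a. a > 0 \<Longrightarrow> (\<lambda>v. exp (- a * (norm (q + v))\<^sup>2)) summable_on S"
    and nz: "\<And>v. v \<in> S \<Longrightarrow> q + v \<noteq> 0"
  obtains L Ls where "Ls \<longlonglongrightarrow> L"
    "\<And>n. (\<Sum>\<^sub>\<infinity>v\<in>S. direct_integral (signed_density (gs n)) (q + v)) = ereal (Ls n)"
    "(\<Sum>\<^sub>\<infinity>v\<in>S. direct_integral (signed_density g) (q + v)) = ereal L"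
proof -
  obtain m where m: "m > 0" "\<And>v. v \<in> S \<Longrightarrow> m \<le> (norm (q + v))\<^sup>2"
    using norm_bounded_below_if_summable[of q S] summ[of 1] nz by auto
  define I where "I g v = (LINT t:{1..}|lborel. g t * exp (- (norm (q + v))\<^sup>2 * t))" for g :: "real \<Rightarrow> real" and v
  \<comment> \<open>The gap \<open>m\<close> makes this majorant independent of \<open>v\<close>, so
    its integral \<open>J\<close> is one constant for the whole lattice sum.\<close>
  define H where "H t = 3 * (t * exp (- (m / 2) * t))" for t
  define J where "J = (LINT t:{1..}|lborel. H t)"
  have H: "set_integrable lborel {1..} H"
    unfolding H_def using m by (intro set_integrable_mult_right set_integrable_mult_exp_minus) auto
  have bound: "norm (I g v) \<le> exp (- (1/2) * (norm (q + v))\<^sup>2) * J"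
    if "v \<in> S" "moderate_density g" for v g
  proof -
    have "norm (I g v) \<le> (LINT t:{1..}|lborel. norm (g t * exp (- (norm (q + v))\<^sup>2 * t)))"
      unfolding I_def using nz that by (intro set_integral_norm_bound set_integrable_direct_integrand) auto
    also have "\<dots> \<le> (LINT t:{1..}|lborel. exp (- (norm (q + v))\<^sup>2 / 2) * H t)"
    proof (rule set_integral_mono)
      show "set_integrable lborel {1..} (\<lambda>t. norm (g t * exp (- (norm (q + v))\<^sup>2 * t)))"
        using nz that by (intro set_integrable_norm set_integrable_direct_integrand) auto
      show "set_integrable lborel {1..} (\<lambda>t. exp (- (norm (q + v))\<^sup>2 / 2) * H t)"
        using H by (rule set_integrable_mult_right)
    qed (use direct_integrand_bound[OF that(2) _ m(2)[OF that(1)]] in \<open>auto simp: H_def\<close>)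
    finally show ?thesis
      by (simp add: J_def)
  qed
  have dom: "(\<lambda>v. exp (- (1/2) * (norm (q + v))\<^sup>2) * J) summable_on S"
    by (intro summable_on_cmult_left summ) auto
  have I_summable: "I g summable_on S" if "moderate_density g" for g
  proof (rule abs_summable_summable)
    show "(\<lambda>v. norm (I g v)) summable_on S"
      using dom bound[OF _ that] by (rule Infinite_Sum.abs_summable_on_comparison_test')
  qed
  have eq: "(\<Sum>\<^sub>\<infinity>v\<in>S. direct_integral (signed_density g) (q + v)) = ereal (infsum (I g) S)"
    if "moderate_density g" for g
    using infsum_ereal[OF I_summable[OF that]] nz that
    by (simp add: direct_integral_nonzero I_def cong: infsum_cong)
  have "(\<lambda>n. infsum (I (gs n)) S) \<longlonglongrightarrow> infsum (I g) S"
  proof (rule tendsto_infsum_dominated[OF dom])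
    show "(\<lambda>n. I (gs n) v) \<longlonglongrightarrow> I g v" if "v \<in> S" for v
      unfolding I_def set_lebesgue_integral_def
    proof (rule integral_dominated_convergence)
      show "integrable lborel (\<lambda>t. indicator {1..} t *\<^sub>R (exp (- (norm (q + v))\<^sup>2 / 2) * H t))"
        using set_integrable_mult_right[OF H] by (simp add: set_integrable_def)
      show "AE t in lborel. norm (indicator {1..} t *\<^sub>R (gs n t * exp (- (norm (q + v))\<^sup>2 * t)))
          \<le> indicator {1..} t *\<^sub>R (exp (- (norm (q + v))\<^sup>2 / 2) * H t)" for n
        using direct_integrand_bound[OF gn _ m(2)[OF that]]
        by (auto intro!: AE_I2 simp: H_def split: split_indicator)
      show "AE t in lborel. (\<lambda>n. indicator {1..} t *\<^sub>R (gs n t * exp (- (norm (q + v))\<^sup>2 * t)))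
          \<longlonglongrightarrow> indicator {1..} t *\<^sub>R (g t * exp (- (norm (q + v))\<^sup>2 * t))"
        by (auto intro!: AE_I2 tendsto_intros lim split: split_indicator)
    qed (use moderate_densityD(1)[OF g] moderate_densityD(1)[OF gn] in auto)
  qed (use bound gn in auto)
  then show thesis
    using that eq g gn by blast
qed

section \<open>The dual integrals and their lattice sum\<close>

lemma powr_le_exp:
  fixes c p u :: real
  assumes "c > 0" "p > 0" "u > 0"
  shows "u powr p \<le> (p / c) powr p * exp (c * u)"
proof -
  \<comment> \<open>The inequality x <= exp x at this point, raised to the power p, gives the
    claim.\<close>
  have "c * u / p \<le> exp (c * u / p)"
    using exp_ge_add_one_self[of "c * u / p"] by linarith
  then have "u \<le> p / c * exp (c * u / p)"
    using assms by (simp add: field_simps)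
  then have "u powr p \<le> (p / c * exp (c * u / p)) powr p"
    using assms by (intro powr_mono2) auto
  also have "\<dots> = (p / c) powr p * exp (c * u / p) powr p"
    using assms by (subst powr_mult) auto
  also have "exp (c * u / p) powr p = exp (c * u)"
    using assms by (simp add: powr_def)
  finally show ?thesis .
qed

text \<open>Here \<open>r\<close> stands for |w|^2, since the dual vector enters only through its
  norm.\<close>

definition dual_integrand :: "real \<Rightarrow> real \<Rightarrow> real \<Rightarrow> real" where
  "dual_integrand d r t = pi powr (d / 2) / t powr (d / 2) * exp (- pi\<^sup>2 * r / t)"

lemma dual_integrand_measurable [measurable]: "dual_integrand d r \<in> borel_measurable borel"
  unfolding dual_integrand_def by measurable

text \<open>The exponent pi^2 r / t is split into halves. In one, 1/t > 1 leaves a Gaussian in the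
  dual vector; in the other, r >= m leaves exp(-c/t), which suppresses the negative powers of t. The
  constant depends on neither \<open>g\<close>, \<open>r\<close> nor \<open>t\<close>.\<close>

lemma dual_integrand_bound:
  fixes d m :: real
  assumes "d \<ge> 0" "m > 0"
  obtains C where "\<And>g r t. moderate_density g \<Longrightarrow> m \<le> r \<Longrightarrow> 0 < t \<Longrightarrow> t < 1
    \<Longrightarrow> \<bar>g t * dual_integrand d r t\<bar> \<le> C * exp (- (pi\<^sup>2 / 2) * r)"
proof
  \<comment> \<open>The order of the singularity at t = 0: d/2 from the integrand and 2 from the
    bound on \<open>g\<close>.\<close>
  define p where "p = d / 2 + 2"
  define c where "c = pi\<^sup>2 / 2 * m"
  have p: "p > 0" and c: "c > 0" using assms by (auto simp: p_def c_def)
  let ?C = "3 * pi powr (d / 2) * (p / c) powr p"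
  fix g r t assume g: "moderate_density g" and mr: "m \<le> r" and t: "0 < t" "t < (1::real)"
  have E: "exp (- pi\<^sup>2 * r / t) \<le> exp (- (pi\<^sup>2 / 2) * r) * exp (- c / t)"
  proof -
    have "pi\<^sup>2 / 2 * r * 1 \<le> pi\<^sup>2 / 2 * r * (1 / t)"
      using t mr assms by (intro mult_left_mono) (auto simp: field_simps)
    moreover have "c * (1 / t) \<le> pi\<^sup>2 / 2 * r * (1 / t)"
      using t mr by (intro mult_right_mono) (auto simp: c_def)
    ultimately have "pi\<^sup>2 / 2 * r * 1 + c * (1 / t) \<le> pi\<^sup>2 / 2 * r * (1 / t) + pi\<^sup>2 / 2 * r * (1 / t)"
      by (rule add_mono)
    also have "\<dots> = pi\<^sup>2 * r * (1 / t)"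
      by simp
    finally have "pi\<^sup>2 / 2 * r + c * (1 / t) \<le> pi\<^sup>2 * r * (1 / t)"
      by simp
    then show ?thesis
      by (simp add: exp_add[symmetric])
  qed
  have P: "(1 / t) powr p * exp (- c / t) \<le> (p / c) powr p"
    using powr_le_exp[OF c p, of "1 / t"] t by (simp add: exp_minus field_simps)
  have G: "\<bar>g t\<bar> \<le> 3 * (1 / t) powr 2"
    using moderate_densityD(5)[OF g t] t by (simp add: powr_divide)
  have D: "(1 / t) powr (d / 2) = 1 / t powr (d / 2)"
    using t by (simp add: powr_divide)
  have Q: "(1 / t) powr p = (1 / t) powr (d / 2) * (1 / t) powr 2"
    using t by (simp add: p_def powr_add)
  have "\<bar>g t * dual_integrand d r t\<bar>
      = \<bar>g t\<bar> * (pi powr (d / 2) * (1 / t) powr (d / 2) * exp (- pi\<^sup>2 * r / t))"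
    by (simp add: dual_integrand_def abs_mult D)
  also have "\<dots> \<le> (3 * (1 / t) powr 2) *
      (pi powr (d / 2) * (1 / t) powr (d / 2) * (exp (- (pi\<^sup>2 / 2) * r) * exp (- c / t)))"
    by (intro mult_mono G mult_left_mono E) auto
  also have "\<dots> = 3 * pi powr (d / 2) * exp (- (pi\<^sup>2 / 2) * r) * ((1 / t) powr p * exp (- c / t))"
    unfolding Q by (simp only: mult_ac)
  also have "\<dots> \<le> 3 * pi powr (d / 2) * exp (- (pi\<^sup>2 / 2) * r) * (p / c) powr p"
    by (intro mult_left_mono P) auto
  finally show "\<bar>g t * dual_integrand d r t\<bar> \<le> ?C * exp (- (pi\<^sup>2 / 2) * r)"
    by (simp only: mult_ac)
qed

text \<open>Both parts of the signed measure are integrable because they are bounded by the absolute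
  value of the whole integrand, so the two integrals can be recombined by max(0, g) - max(0, -g) =
  g.\<close>

lemma dual_integral_signed_density:
  fixes w :: "real^'n"
  assumes [measurable]: "g \<in> borel_measurable borel"
    and int: "set_integrable lborel {0<..<1} (\<lambda>t. g t * dual_integrand (real CARD('n)) ((norm w)\<^sup>2) t)"
  shows "dual_integral (signed_density g) w
    = (LINT t:{0<..<1}|lborel. g t * dual_integrand (real CARD('n)) ((norm w)\<^sup>2) t)"
proof -
  let ?f = "dual_integrand (real CARD('n)) ((norm w)\<^sup>2)"
  have f: "?f t = pi powr (real CARD('n) / 2) / t powr (real CARD('n) / 2) * exp (- pi\<^sup>2 * (norm w)\<^sup>2 / t)" for t
    by (simp add: dual_integrand_def)
  \<comment> \<open>Used with \<open>h\<close> equal to \<open>g\<close> and to its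
    negative.\<close>
  have part: "set_integrable lborel {0<..<1} (\<lambda>t. max 0 (h t) * ?f t)"
    if [measurable]: "h \<in> borel_measurable borel" and h: "\<And>t. \<bar>h t\<bar> = \<bar>g t\<bar>" for h
    using int
  proof (rule set_integrable_bound)
    show "AE t in lborel. t \<in> {0<..<1} \<longrightarrow> norm (max 0 (h t) * ?f t) \<le> norm (g t * ?f t)"
    proof (intro AE_I2 impI)
      fix t
      have "\<bar>max 0 (h t)\<bar> * \<bar>?f t\<bar> \<le> \<bar>g t\<bar> * \<bar>?f t\<bar>"
        unfolding h[symmetric] by (intro mult_right_mono) auto
      then show "norm (max 0 (h t) * ?f t) \<le> norm (g t * ?f t)"
        by (simp add: abs_mult)
    qed
  qed (auto simp: set_borel_measurable_def)
  have "dual_integral (signed_density g) w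
      = (LINT t:{0<..<1}|fst (signed_density g). ?f t) - (LINT t:{0<..<1}|snd (signed_density g). ?f t)"
    by (simp add: dual_integral_def Let_def f)
  also have "\<dots> = (LINT t:{0<..<1}|lborel. max 0 (g t) * ?f t) - (LINT t:{0<..<1}|lborel. max 0 (- g t) * ?f t)"
    unfolding signed_density_def fst_conv snd_conv
    by (intro arg_cong2[where f = "(-)"] set_integral_density_positive_reals) auto
  also have "\<dots> = (LINT t:{0<..<1}|lborel. max 0 (g t) * ?f t - max 0 (- g t) * ?f t)"
    by (intro set_integral_diff(2)[symmetric] part) auto
  also have "(\<lambda>t. max 0 (g t) * ?f t - max 0 (- g t) * ?f t) = (\<lambda>t. g t * ?f t)"
    by (auto simp: max_def)
  finally show ?thesis .
qed

lemma tendsto_dual_sum: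
  fixes V :: "real^'n^'n"
  assumes gn: "\<And>n. moderate_density (gs n)" and g: "moderate_density g"
    and lim: "\<And>t. t > 0 \<Longrightarrow> (\<lambda>n. gs n t) \<longlonglongrightarrow> g t"
    and summ: "\<And>a. a > 0 \<Longrightarrow> (\<lambda>w. exp (- a * (norm w)\<^sup>2)) summable_on dual_lattice V"
  shows "(\<lambda>n. dual_sum V (signed_density (gs n)) q) \<longlonglongrightarrow> dual_sum V (signed_density g) q"
proof -
  let ?S = "dual_lattice V - {0}" and ?f = "\<lambda>w. dual_integrand (real CARD('n)) ((norm w)\<^sup>2)"
  have "(\<lambda>w. exp (- (norm (0 + w))\<^sup>2)) summable_on dual_lattice V"
    using summ[of 1] by simp
  then obtain m where m: "m > 0"
    "\<And>w. w \<in> dual_lattice V \<Longrightarrow> 0 + w \<noteq> 0 \<Longrightarrow> m \<le> (norm (0 + w))\<^sup>2"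
    by (rule norm_bounded_below_if_summable) blast
  obtain C where C: "\<And>g r t. moderate_density g \<Longrightarrow> m \<le> r \<Longrightarrow> 0 < t \<Longrightarrow> t < 1
      \<Longrightarrow> \<bar>g t * dual_integrand (real CARD('n)) r t\<bar> \<le> C * exp (- (pi\<^sup>2 / 2) * r)"
    by (rule dual_integrand_bound[OF of_nat_0_le_iff m(1)]) blast
  \<comment> \<open>This majorant does not depend on t. As the interval (0,1) has length 1, it
    bounds the integral as well as the integrand, and it is summable in \<open>w\<close>.\<close>
  define H where "H w = C * exp (- (pi\<^sup>2 / 2) * (norm w)\<^sup>2)" for w :: "real^'n"
  have bound: "\<bar>g t * ?f w t\<bar> \<le> H w" if "moderate_density g" "w \<in> ?S" "0 < t" "t < 1" for g w t
    unfolding H_def using C[OF that(1) _ that(3,4), of "(norm w)\<^sup>2"] m(2)[of w] that(2) by simp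
  have const: "set_integrable lborel {0<..<1::real} (\<lambda>_. c)" for c :: real
    unfolding set_integrable_def by (intro integrableI_bounded_set_indicator) auto
  have integrable: "set_integrable lborel {0<..<1} (\<lambda>t. g t * ?f w t)"
    if "moderate_density g" "w \<in> ?S" for g w
    using const[of "H w"]
  proof (rule set_integrable_bound)
    show "set_borel_measurable lborel {0<..<1} (\<lambda>t. g t * ?f w t)"
      using moderate_densityD(1)[OF that(1)] by (auto simp: set_borel_measurable_def)
    show "AE t in lborel. t \<in> {0<..<1} \<longrightarrow> norm (g t * ?f w t) \<le> norm (H w)"
      using bound[OF that] by (auto intro!: AE_I2 order_trans[OF _ abs_ge_self])
  qed
  have eq: "dual_integral (signed_density g) w = (LINT t:{0<..<1}|lborel. g t * ?f w t)"
    if "moderate_density g" "w \<in> ?S" for g w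
    using moderate_densityD(1)[OF that(1)] integrable[OF that] by (rule dual_integral_signed_density)
  have le: "\<bar>dual_integral (signed_density g) w\<bar> \<le> H w" if "moderate_density g" "w \<in> ?S" for g w
  proof -
    have "\<bar>dual_integral (signed_density g) w\<bar> \<le> (LINT t:{0<..<1}|lborel. norm (g t * ?f w t))"
      unfolding eq[OF that] real_norm_def[symmetric]
      by (intro set_integral_norm_bound integrable that)
    also have "\<dots> \<le> (LINT t:{0<..<1::real}|lborel. H w)"
      using bound[OF that] by (intro set_integral_mono set_integrable_norm integrable const that) auto
    also have "\<dots> = H w"
      by (simp add: set_lebesgue_integral_def)
    finally show ?thesis .
  qed
  show ?thesis
    unfolding dual_sum_def
  proof (rule tendsto_infsum_dominated)
    have "H summable_on dual_lattice V"
      unfolding H_def[abs_def] by (intro summable_on_cmult_right summ) auto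
    then show "H summable_on ?S"
      by (rule summable_on_subset) auto
    \<comment> \<open>The phase factor has modulus 1.\<close>
    show "norm (exp (2 * of_real pi * \<i> * of_real (w \<bullet> q)) *
        complex_of_real (dual_integral (signed_density (gs n)) w)) \<le> H w" if "w \<in> ?S" for n w
      using le[OF gn that] by (simp add: norm_mult norm_exp_eq_Re)
    show "(\<lambda>n. exp (2 * of_real pi * \<i> * of_real (w \<bullet> q)) *
        complex_of_real (dual_integral (signed_density (gs n)) w))
      \<longlonglongrightarrow> exp (2 * of_real pi * \<i> * of_real (w \<bullet> q)) *
        complex_of_real (dual_integral (signed_density g) w)" if "w \<in> ?S" for w
    proof (intro tendsto_intros)
      show "(\<lambda>n. dual_integral (signed_density (gs n)) w) \<longlonglongrightarrow> dual_integral (signed_density g) w"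
        unfolding eq[OF gn that] eq[OF g that] set_lebesgue_integral_def
      proof (rule integral_dominated_convergence)
        show "integrable lborel (\<lambda>t. indicator {0<..<1::real} t *\<^sub>R H w)"
          using const by (simp add: set_integrable_def)
        show "AE t in lborel. norm (indicator {0<..<1} t *\<^sub>R (gs n t * ?f w t))
            \<le> indicator {0<..<1} t *\<^sub>R H w" for n
          using bound[OF gn that] by (auto intro!: AE_I2 split: split_indicator)
        show "AE t in lborel. (\<lambda>n. indicator {0<..<1} t *\<^sub>R (gs n t * ?f w t))
            \<longlonglongrightarrow> indicator {0<..<1} t *\<^sub>R (g t * ?f w t)"
          by (auto intro!: AE_I2 tendsto_intros lim split: split_indicator)
      qed (use moderate_densityD(1)[OF g] moderate_densityD(1)[OF gn] in auto)
    qed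
  qed
qed

section \<open>Convergence of the kernel for pointwise convergent moderate densities\<close>

lemma tendsto_periodic_kernel:
  fixes V :: "real^'n^'n"
  assumes V: "invertible V" and gn: "\<And>n. moderate_density (gs n)" and g: "moderate_density g"
    and lim: "\<And>t. t > 0 \<Longrightarrow> (\<lambda>n. gs n t) \<longlonglongrightarrow> g t"
  shows "(\<lambda>n. periodic_kernel V (signed_density (gs n)) x y) \<longlonglongrightarrow> periodic_kernel V (signed_density g) x y"
proof -
  let ?q = "x - y"
  obtain W where W: "W ** V = mat 1" "V ** W = mat 1"
    using V by (auto simp: invertible_def)
  then have W': "invertible W" by (auto simp: invertible_def)
  have V': "invertible (transpose V)"
    using V by (simp add: invertible_det_nz)
  \<comment> \<open>The inverse \<open>W\<close> turns lattice vectors into integer vectors.\<close>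
  have direct: "(\<lambda>v. exp (- a * (norm (?q + v))\<^sup>2)) summable_on lattice V" if "a > 0" for a
    using W' integer_coordinates_lattice[OF W(1)] that by (rule summable_on_exp_norm_lattice)
  have dual: "(\<lambda>w. exp (- a * (norm w)\<^sup>2)) summable_on dual_lattice V" if "a > 0" for a
    using summable_on_exp_norm_lattice[OF V' integer_coordinates_dual_lattice that, where q = 0] by simp
  show ?thesis
  proof (cases "\<exists>v\<in>lattice V. ?q + v = 0")
    case True
    then obtain v where v: "v \<in> lattice V" "?q + v = 0" by blast
    \<comment> \<open>The dual part is real, so all the kernels in the sequence and the limit kernel
      are infinite here.\<close>
    have "(\<Sum>\<^sub>\<infinity>v\<in>lattice V. direct_integral (signed_density g) (?q + v)) = \<infinity>"
      if "moderate_density g" for g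
      using v(1) by (rule infsum_ereal_eq_infinity[rotated])
        (simp_all only: v(2) direct_integral_zero[OF that], simp add: direct_integral_moderate[OF that])
    then show ?thesis
      using g gn by (simp add: periodic_kernel_def)
  next
    case False
    then obtain L Ls where "Ls \<longlonglongrightarrow> L"
      "\<And>n. (\<Sum>\<^sub>\<infinity>v\<in>lattice V. direct_integral (signed_density (gs n)) (?q + v)) = ereal (Ls n)"
      "(\<Sum>\<^sub>\<infinity>v\<in>lattice V. direct_integral (signed_density g) (?q + v)) = ereal L"
      using tendsto_direct_sum[OF gn g lim direct] by (metis (no_types))
    moreover have "(\<lambda>n. dual_sum V (signed_density (gs n)) ?q) \<longlonglongrightarrow> dual_sum V (signed_density g) ?q"
      using gn g lim dual by (rule tendsto_dual_sum)
    ultimately show ?thesis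
      by (auto simp: periodic_kernel_def intro!: tendsto_intros)
  qed
qed

section \<open>The logarithmic and log-Riesz densities near s = 0\<close>

lemma moderate_density_inverse: "moderate_density (\<lambda>t. 1 / t)"
  unfolding moderate_density_def
proof (intro conjI allI impI)
  fix t :: real assume t: "1 \<le> t"
  show "1 / (2 * t) \<le> 1 / t" using t by (simp add: field_simps)
  have "1 * 1 \<le> t * t" using t by (intro mult_mono) auto
  then show "1 / t \<le> 3 * t" using t by (simp add: field_simps)
next
  fix t :: real assume "0 < t \<and> t < 1"
  then show "\<bar>1 / t\<bar> \<le> 3 / t\<^sup>2" by (simp add: field_simps power2_eq_square)
qed measurable

text \<open>With e = s/2 - 1 this covers the log-Riesz densities for all small s at once. The bounds
  rest on 0 <= log t <= t - 1 for t >= 1 and on -log t <= 1/t - 1 for t < 1.\<close>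

lemma moderate_density_power_log:
  assumes a: "0 \<le> a" "a \<le> 1" and b: "1 / 2 \<le> b" "b \<le> 2" and e: "- 1 \<le> e" "e \<le> 0"
  shows "moderate_density (\<lambda>t. t powr e * (a * ln t + b))"
  unfolding moderate_density_def
proof (intro conjI allI impI)
  fix t :: real assume t: "1 \<le> t"
  have low: "1 / t \<le> t powr e" and up: "t powr e \<le> 1"
    using powr_mono[OF e(1) t] powr_mono[OF e(2) t] t by (auto simp: powr_minus_divide)
  have ln: "0 \<le> ln t" "ln t \<le> t - 1"
    using t ln_le_minus_one[of t] by auto
  then have aln: "0 \<le> a * ln t" "a * ln t \<le> 1 * ln t"
    using a mult_right_mono[of a 1 "ln t"] by auto
  have "1 / t * (1 / 2) \<le> t powr e * (a * ln t + b)"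
    using low aln b t by (intro mult_mono) auto
  then show "1 / (2 * t) \<le> t powr e * (a * ln t + b)" by simp
  have "t powr e * (a * ln t + b) \<le> 1 * (3 * t)"
    using up aln b t ln by (intro mult_mono) auto
  then show "t powr e * (a * ln t + b) \<le> 3 * t" by simp
next
  fix t :: real assume t: "0 < t \<and> t < 1"
  have "t powr e \<le> t powr (- 1)"
    using e t by (intro powr_mono') auto
  then have p: "t powr e \<le> 1 / t"
    using t by (simp add: powr_minus_divide)
  have ln: "ln t \<le> 0" "- ln t \<le> 1 / t - 1"
    using t ln_le_minus_one[of "1 / t"] by (auto simp: ln_div)
  have "\<bar>a * ln t\<bar> \<le> 1 * \<bar>ln t\<bar>"
    using a unfolding abs_mult by (intro mult_right_mono) auto
  moreover have "1 \<le> 1 / t" using t by simp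
  ultimately have "\<bar>a * ln t + b\<bar> \<le> 3 / t"
    using ln b by (simp add: abs_le_iff)
  then have "t powr e * \<bar>a * ln t + b\<bar> \<le> 1 / t * (3 / t)"
    using p t by (intro mult_mono) auto
  then show "\<bar>t powr e * (a * ln t + b)\<bar> \<le> 3 / t\<^sup>2"
    by (simp add: abs_mult power2_eq_square)
qed measurable

text \<open>The reciprocal Gamma function is continuous at 0 and vanishes there.\<close>

lemma tendsto_inverse_Gamma_0: "((\<lambda>u::real. 1 / Gamma u) \<longlongrightarrow> 0) (at_right 0)"
proof -
  have "isCont (rGamma :: real \<Rightarrow> real) 0"
    by (intro isCont_rGamma continuous_ident)
  then have "((rGamma :: real \<Rightarrow> real) \<longlongrightarrow> 0) (at_right 0)"
    unfolding isCont_def by (auto intro: filterlim_at_within_not_equal tendsto_within_subset)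
  moreover have "rGamma = (\<lambda>u::real. 1 / Gamma u)"
    by (simp add: fun_eq_iff rGamma_inverse_Gamma inverse_eq_divide)
  ultimately show ?thesis by simp
qed

text \<open>The poles of psi and Gamma at 0 cancel: the recurrences rewrite the quotient as (1 - u
  psi(u+1)) / Gamma(u+1), which is continuous at 0 with value 1 / Gamma(1) = 1.\<close>

lemma tendsto_Digamma_over_Gamma_0: "((\<lambda>u::real. - Digamma u / Gamma u) \<longlongrightarrow> 1) (at_right 0)"
proof -
  have "isCont (\<lambda>u::real. (1 - u * Digamma (u + 1)) / Gamma (u + 1)) 0"
    by (intro continuous_intros) auto
  then have "((\<lambda>u::real. (1 - u * Digamma (u + 1)) / Gamma (u + 1)) \<longlongrightarrow> 1) (at_right 0)"
    unfolding isCont_def by (auto intro: tendsto_within_subset)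
  moreover have "\<forall>\<^sub>F u in at_right 0. (1 - u * Digamma (u + 1)) / Gamma (u + 1) = - Digamma u / Gamma (u::real)"
    unfolding eventually_at_right_field
  proof (intro exI[of _ 1] conjI allI impI)
    fix u :: real assume "0 < u" "u < 1"
    then have "Gamma (u + 1) = u * Gamma u" "Digamma (u + 1) = Digamma u + 1 / u" "Gamma u > 0"
      by (auto intro!: Gamma_plus1 Digamma_plus1 elim!: nonpos_Ints_cases)
    then show "(1 - u * Digamma (u + 1)) / Gamma (u + 1) = - Digamma u / Gamma u"
      using \<open>0 < u\<close> by (simp add: field_simps)
  qed simp
  ultimately show ?thesis
    by (simp add: filterlim_cong)
qed

theorem theorem3p7:
  fixes V :: "real^'n^'n" and x y :: "real^'n"
  assumes "det V = 1"
  shows "((\<lambda>s. K_log_Riesz V s x y) \<longlongrightarrow> K_log V x y) (at_right 0)"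
proof -
  define a where "a u = 1 / Gamma u" for u :: real
  define b where "b u = - Digamma u / Gamma u" for u :: real
  \<comment> \<open>The factor 1 / Gamma(s/2) is distributed over the difference because psi(s/2)
    alone diverges as s tends to 0.\<close>
  define h where "h s t = t powr (s / 2 - 1) * (a (s / 2) * ln t + b (s / 2))" for s t :: real
  have lim_a: "(a \<longlongrightarrow> 0) (at_right 0)" and lim_b: "(b \<longlongrightarrow> 1) (at_right 0)"
    unfolding a_def[abs_def] b_def[abs_def]
    by (rule tendsto_inverse_Gamma_0 tendsto_Digamma_over_Gamma_0)+
  have K: "K_log_Riesz V s = periodic_kernel V (signed_density (h s))" for s
  proof -
    have "(\<lambda>t. 1 / Gamma (s / 2) * t powr (s / 2 - 1) * (ln t - Digamma (s / 2))) = h s"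
      by (auto simp: h_def a_def b_def algebra_simps diff_divide_distrib)
    then show ?thesis by (simp add: K_log_Riesz_def log_Riesz_measure_def)
  qed
  have "\<forall>\<^sub>F u in at_right 0. a u < 1 \<and> 1 / 2 < b u \<and> b u < 2"
    using order_tendstoD(2)[OF lim_a, of 1] order_tendstoD(1)[OF lim_b, of "1/2"]
      order_tendstoD(2)[OF lim_b, of 2] by (auto intro: eventually_conj)
  then obtain \<delta> where \<delta>: "\<delta> > 0" "\<And>u. 0 < u \<Longrightarrow> u < \<delta> \<Longrightarrow> a u < 1 \<and> 1 / 2 < b u \<and> b u < 2"
    by (auto simp: eventually_at_right_field)
  \<comment> \<open>The bound \<open>2 * \<delta>\<close> puts s/2 below \<open>\<delta>\<close>,
    and the bound 2 keeps the exponent s/2 - 1 negative.\<close>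
  have moderate: "moderate_density (h s)" if "0 < s" "s < min (2 * \<delta>) 2" for s
    unfolding h_def using that \<delta>(2)[of "s / 2"] Gamma_real_pos[of "s / 2"]
    by (intro moderate_density_power_log) (auto simp: a_def)
  show ?thesis
  \<comment> \<open>Dominated convergence is a statement about sequences. Only sequences inside this
    interval have to be considered, so every term has a moderate density.\<close>
  proof (rule tendsto_at_right_sequentially)
    show "0 < min (2 * \<delta>) 2" using \<delta> by simp
    fix S :: "nat \<Rightarrow> real"
    assume S: "\<And>n. 0 < S n" "\<And>n. S n < min (2 * \<delta>) 2" "S \<longlonglongrightarrow> 0"
    have "(\<lambda>n. S n / 2) \<longlonglongrightarrow> 0"
      using tendsto_divide[OF S(3) tendsto_const[of 2]] by simp
    then have half: "filterlim (\<lambda>n. S n / 2) (at_right 0) sequentially"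
      using S(1) by (simp add: filterlim_at less_imp_neq[OF S(1), THEN not_sym])
    have "(\<lambda>n. h (S n) t) \<longlonglongrightarrow> 1 / t" if "t > 0" for t
    proof -
      have "(\<lambda>n. h (S n) t) \<longlonglongrightarrow> t powr (0 - 1) * (0 * ln t + 1)"
        unfolding h_def using that \<open>(\<lambda>n. S n / 2) \<longlonglongrightarrow> 0\<close>
          filterlim_compose[OF lim_a half] filterlim_compose[OF lim_b half]
        by (intro tendsto_intros) auto
      then show ?thesis using that by (simp add: powr_minus_divide)
    qed
    moreover have "invertible V" using assms by (simp add: invertible_det_nz)
    ultimately show "(\<lambda>n. K_log_Riesz V (S n) x y) \<longlonglongrightarrow> K_log V x y"
      unfolding K K_log_def log_measure_def
      using moderate[OF S(1,2)] moderate_density_inverse by (intro tendsto_periodic_kernel) auto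
  qed
qed

end
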